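(* Let $n\ge2$ and $\tau_i=(c_i,d_i,p_i,J_i)$, $i=1,\dots,n$, nonnegative integers with $c_i\ge1$, $p_i\ge1$, $c_i\le d_i\le p_i$, $J_i=0$ for all $i$, $\sum_{i<n}c_i/p_i<1$ and $\sum_{i\le n}c_i/p_i\le1$; let $p_{\max}=\max_{i\le n}p_i$ and $r_n=\min\{t\in\mathbb{Z}_{\ge0}: t\ge c_n+\sum_{i<n}c_i\lceil t/p_i\rceil\}$. For an integer $k$ let \[ \mathcal{M}(k)=\min\Big\{s+\sum_{i<n}c_ix_i : s+p_ix_i\ge k\ \forall i<n,\ s\in\mathbb{Z}_{\ge0},\ x\in\mathbb{Z}^{n-1}\Big\}, \] and suppose $\mathcal{M}(k)$ can be computed in time at most $T_{\mathcal{M}}$ for every $k$. Then $r_n$ can be computed in time $O(T_{\mathcal{M}}\log p_{\max})$.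
   Context: Running times count arithmetic operations on numbers from the input. *)

theory Defs
  imports Complex_Main
begin

text \<open>
  While programs over the integers with random-access memory. Memory consists of named arrays of
  integers (a scalar is an array used at a single index); the input is a read-only sequence of
  integers. Running time is unit cost: each arithmetic operation, comparison, constant,
  memory or input access, assignment and branch counts one step, whatever the size of the numbers.
\<close>

type_synonym vname = string
type_synonym state = "vname \<Rightarrow> int \<Rightarrow> int"

datatype aexp =
    Lit int
  | Var vname aexp
  | Read aexp
  | Add aexp aexp
  | Sub aexp aexp
  | Mul aexp aexp
  | Quot aexp aexp

datatype bexp =
    Less aexp aexp
  | Neg bexp
  | Conj bexp bexp

datatype com =
    Skip
  | Assign vname aexp aexp
  | Seq com com
  | Cond bexp com com
  | Loop bexp com

text \<open>Input addresses start at 0; reads outside the input yield 0. \<^const>\<open>Quot\<close> rounds down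
  (and is 0 for divisor 0).\<close>

fun aval :: "int list \<Rightarrow> aexp \<Rightarrow> state \<Rightarrow> int" where
  "aval inp (Lit z) s = z"
| "aval inp (Var x i) s = s x (aval inp i s)"
| "aval inp (Read i) s =
    (let a = aval inp i s in if 0 \<le> a \<and> a < int (length inp) then inp ! nat a else 0)"
| "aval inp (Add a b) s = aval inp a s + aval inp b s"
| "aval inp (Sub a b) s = aval inp a s - aval inp b s"
| "aval inp (Mul a b) s = aval inp a s * aval inp b s"
| "aval inp (Quot a b) s = aval inp a s div aval inp b s"

fun acost :: "aexp \<Rightarrow> nat" where
  "acost (Lit z) = 1"
| "acost (Var x i) = 1 + acost i"
| "acost (Read i) = 1 + acost i"
| "acost (Add a b) = 1 + acost a + acost b"
| "acost (Sub a b) = 1 + acost a + acost b"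
| "acost (Mul a b) = 1 + acost a + acost b"
| "acost (Quot a b) = 1 + acost a + acost b"

fun bval :: "int list \<Rightarrow> bexp \<Rightarrow> state \<Rightarrow> bool" where
  "bval inp (Less a b) s \<longleftrightarrow> aval inp a s < aval inp b s"
| "bval inp (Neg b) s \<longleftrightarrow> \<not> bval inp b s"
| "bval inp (Conj b b') s \<longleftrightarrow> bval inp b s \<and> bval inp b' s"

fun bcost :: "bexp \<Rightarrow> nat" where
  "bcost (Less a b) = 1 + acost a + acost b"
| "bcost (Neg b) = 1 + bcost b"
| "bcost (Conj b b') = 1 + bcost b + bcost b'"

text \<open>\<open>exec inp P s t s'\<close>: on input \<open>inp\<close>, started in \<open>s\<close>, program \<open>P\<close> halts after exactly
  \<open>t\<close> steps in \<open>s'\<close>.\<close>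

inductive exec :: "int list \<Rightarrow> com \<Rightarrow> state \<Rightarrow> nat \<Rightarrow> state \<Rightarrow> bool" for inp where
  Skip: "exec inp Skip s 1 s"
| Assign: "exec inp (Assign x i a) s (1 + acost i + acost a)
    (s(x := (s x)(aval inp i s := aval inp a s)))"
| Seq: "exec inp P s t s' \<Longrightarrow> exec inp Q s' t' s'' \<Longrightarrow> exec inp (Seq P Q) s (t + t') s''"
| CondTrue: "bval inp b s \<Longrightarrow> exec inp P s t s' \<Longrightarrow> exec inp (Cond b P Q) s (1 + bcost b + t) s'"
| CondFalse: "\<not> bval inp b s \<Longrightarrow> exec inp Q s t s' \<Longrightarrow> exec inp (Cond b P Q) s (1 + bcost b + t) s'"
| LoopFalse: "\<not> bval inp b s \<Longrightarrow> exec inp (Loop b P) s (1 + bcost b) s"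
| LoopTrue: "bval inp b s \<Longrightarrow> exec inp P s t s' \<Longrightarrow> exec inp (Loop b P) s' t' s'' \<Longrightarrow>
    exec inp (Loop b P) s (1 + bcost b + t + t') s''"

text \<open>Arguments beyond the input are passed in the array \<open>''arg''\<close>, the result is
  returned in \<open>''res''\<close> at index 0. All other memory is uninitialised: a program has to be correct
  and fast for every initial content.\<close>

definition computes :: "com \<Rightarrow> int list \<Rightarrow> int list \<Rightarrow> int \<Rightarrow> real \<Rightarrow> bool" where
  "computes P inp args v T \<longleftrightarrow>
    (\<forall>s. (\<forall>i < length args. s ''arg'' (int i) = args ! i) \<longrightarrow>
      (\<exists>t s'. exec inp P s t s' \<and> s' ''res'' 0 = v \<and> real t \<le> T))"

text \<open>Task \<open>i\<close>, for \<open>1 \<le> i \<le> n\<close>, is \<open>(c i, d i, p i, J i)\<close>; values at other indices are irrelevant.\<close>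

definition task_system ::
    "nat \<Rightarrow> (nat \<Rightarrow> nat) \<Rightarrow> (nat \<Rightarrow> nat) \<Rightarrow> (nat \<Rightarrow> nat) \<Rightarrow> (nat \<Rightarrow> nat) \<Rightarrow> bool" where
  "task_system n c d p J \<longleftrightarrow>
    n \<ge> 2 \<and>
    (\<forall>i\<in>{1..n}. c i \<ge> 1 \<and> p i \<ge> 1 \<and> c i \<le> d i \<and> d i \<le> p i \<and> J i = 0) \<and>
    (\<Sum>i\<in>{1..<n}. real (c i) / real (p i)) < 1 \<and>
    (\<Sum>i\<in>{1..n}. real (c i) / real (p i)) \<le> 1"

definition encode ::
    "nat \<Rightarrow> (nat \<Rightarrow> nat) \<Rightarrow> (nat \<Rightarrow> nat) \<Rightarrow> (nat \<Rightarrow> nat) \<Rightarrow> (nat \<Rightarrow> nat) \<Rightarrow> int list" where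
  "encode n c d p J =
    int n # concat (map (\<lambda>i. [int (c i), int (d i), int (p i), int (J i)]) [1..<Suc n])"

definition p_max :: "nat \<Rightarrow> (nat \<Rightarrow> nat) \<Rightarrow> nat" where
  "p_max n p = Max (p ` {1..n})"

text \<open>Both minima below exist for every task system. In \<open>mixing_min\<close> only the coordinates
  \<open>x 1, \<dots>, x (n - 1)\<close> matter, so \<open>x\<close> stands for an integer vector of length \<open>n - 1\<close>.\<close>

definition response_time :: "nat \<Rightarrow> (nat \<Rightarrow> nat) \<Rightarrow> (nat \<Rightarrow> nat) \<Rightarrow> nat" where
  "response_time n c p =
    (LEAST t::nat. int t \<ge> int (c n) + (\<Sum>i\<in>{1..<n}. int (c i) * \<lceil>real t / real (p i)\<rceil>))"

definition mixing_min :: "nat \<Rightarrow> (nat \<Rightarrow> nat) \<Rightarrow> (nat \<Rightarrow> nat) \<Rightarrow> int \<Rightarrow> int" where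
  "mixing_min n c p k =
    (LEAST m::int. m \<in> {s + (\<Sum>i\<in>{1..<n}. int (c i) * x i) | s x.
       s \<ge> 0 \<and> (\<forall>i\<in>{1..<n}. s + int (p i) * x i \<ge> k)})"

end

theory Submission
  imports Defs
begin

text \<open>
  Substituting \<open>t = k - s\<close>, in which the optimal \<open>x\<^sub>i\<close> is \<open>\<lceil>t / p\<^sub>i\<rceil>\<close>, gives
  \<open>k - \<M>(k) = max {t - \<Sum>i<n. c\<^sub>i \<lceil>t / p\<^sub>i\<rceil> | t \<le> k}\<close>. Nonpositive \<open>t\<close> contribute nothing positive
  because the utilisation of the first \<open>n - 1\<close> tasks is less than 1. Hence \<open>c\<^sub>n \<le> k - \<M>(k)\<close>
  holds iff \<open>r\<^sub>n \<le> k\<close>, and \<open>r\<^sub>n\<close> can be found by doubling followed by bisection. The number of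
  calls is \<open>O(log p_max)\<close> since \<open>t = p\<^sub>n (c\<^sub>1 + \<dots> + c\<^sub>n) \<le> p_max\<^sup>2\<close> satisfies the
  inequality defining \<open>r\<^sub>n\<close>.
\<close>

section \<open>Bounded-time execution\<close>

text \<open>Total correctness with a time budget. The budget is a real upper bound rather than an
  exact count, so it can contain \<open>T\<close> and be relaxed by
  \<open>runs_mono\<close>.\<close>

definition runs :: "int list \<Rightarrow> com \<Rightarrow> state \<Rightarrow> real \<Rightarrow> (state \<Rightarrow> bool) \<Rightarrow> bool" where
  "runs inp P s N Q \<longleftrightarrow> (\<exists>t s'. exec inp P s t s' \<and> real t \<le> N \<and> Q s')"

lemma runs_mono: "runs inp P s N Q \<Longrightarrow> N \<le> N' \<Longrightarrow> (\<And>s'. Q s' \<Longrightarrow> Q' s') \<Longrightarrow> runs inp P s N' Q'"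
  unfolding runs_def by (meson order_trans)

lemma runs_Assign:
  "Q (s(x := (s x)(aval inp i s := aval inp a s))) \<Longrightarrow> 1 + real (acost i) + real (acost a) \<le> N \<Longrightarrow>
    runs inp (Assign x i a) s N Q"
  unfolding runs_def by (force intro: exec.Assign)

text \<open>The postcondition of the first command is the \<open>runs\<close> statement of the
  second, so backward application needs no intermediate assertion.\<close>

lemma runs_Seq:
  "runs inp P s N (\<lambda>s'. runs inp P' s' N' Q) \<Longrightarrow> runs inp (Seq P P') s (N + N') Q"
  unfolding runs_def by (force intro: exec.Seq)

lemma runs_Cond:
  assumes "bval inp b s \<Longrightarrow> runs inp P s N Q" and "\<not> bval inp b s \<Longrightarrow> runs inp P' s N Q"
    and "1 + real (bcost b) + N \<le> N'"
  shows "runs inp (Cond b P P') s N' Q"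
  using assms unfolding runs_def
  by (cases "bval inp b s") (force intro: exec.CondTrue exec.CondFalse)+

lemma runs_LoopFalse:
  "\<not> bval inp b s \<Longrightarrow> Q s \<Longrightarrow> 1 + real (bcost b) \<le> N \<Longrightarrow> runs inp (Loop b P) s N Q"
  unfolding runs_def by (force intro: exec.LoopFalse)

lemma runs_LoopTrue:
  "bval inp b s \<Longrightarrow> runs inp P s N (\<lambda>s'. runs inp (Loop b P) s' N' Q) \<Longrightarrow>
    1 + real (bcost b) + N + N' \<le> N'' \<Longrightarrow> runs inp (Loop b P) s N'' Q"
  unfolding runs_def by (force intro: exec.LoopTrue)

lemma computes_iff_runs:
  "computes P inp args v T \<longleftrightarrow>
    (\<forall>s. (\<forall>i < length args. s ''arg'' (int i) = args ! i) \<longrightarrow>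
      runs inp P s T (\<lambda>s'. s' ''res'' 0 = v))"
  unfolding computes_def runs_def by blast

lemma computes_mono: "computes P inp args v T \<Longrightarrow> T \<le> T' \<Longrightarrow> computes P inp args v T'"
  unfolding computes_def by (meson order_trans)

lemma exec_time_pos: "exec inp P s t s' \<Longrightarrow> 1 \<le> t"
  by (induction rule: exec.induct) auto

text \<open>Every execution takes a step, so a bound on the running time is at least 1. This lets
  constant overheads be absorbed into multiples of \<open>T\<close>.\<close>

lemma computes_time_ge_1:
  assumes "computes P inp [k] v T"
  shows "1 \<le> T"
proof -
  obtain t s' where "exec inp P (\<lambda>_ _. k) t s'" "real t \<le> T"
    using assms unfolding computes_def by fastforce
  then show ?thesis
    using exec_time_pos by fastforce
qed

section \<open>Memory that a program leaves untouched\<close>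

fun assigned :: "com \<Rightarrow> vname set" where
  "assigned Skip = {}"
| "assigned (Assign x i a) = {x}"
| "assigned (Seq P Q) = assigned P \<union> assigned Q"
| "assigned (Cond b P Q) = assigned P \<union> assigned Q"
| "assigned (Loop b P) = assigned P"

lemma finite_assigned: "finite (assigned P)"
  by (induction P) auto

lemma exec_not_assigned: "exec inp P s t s' \<Longrightarrow> x \<notin> assigned P \<Longrightarrow> s' x = s x"
  by (induction rule: exec.induct) auto

text \<open>\<open>computes\<close> quantifies over all initial memories, so \<open>A\<close> may be
  called again on whatever earlier calls left behind. An array it never assigns survives the
  call.\<close>

lemma runs_call:
  assumes "computes A inp [s ''arg'' 0] v T" and "x \<notin> assigned A"
  shows "runs inp A s T (\<lambda>s'. s' ''res'' 0 = v \<and> s' x = s x)"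
proof -
  obtain t s' where "exec inp A s t s'" "s' ''res'' 0 = v" "real t \<le> T"
    using assms(1) unfolding computes_def by fastforce
  then show ?thesis
    using exec_not_assigned[OF _ assms(2)] unfolding runs_def by blast
qed

section \<open>Doubling and bisection\<close>

definition query :: "com \<Rightarrow> aexp \<Rightarrow> com" where
  "query A e = Seq (Assign ''arg'' (Lit 0) e) A"

text \<open>\<open>res\<close> is whatever the last query left there, so the test is meaningful only
  right after a query at the value of \<open>e\<close>.\<close>

definition below :: "aexp \<Rightarrow> aexp \<Rightarrow> bexp" where
  "below e c = Less (Sub e (Var ''res'' (Lit 0))) c"

text \<open>A single array \<open>x\<close> holds the lower end at index 0, the upper end at index 1
  and later the midpoint at index 2, so one fresh name suffices.\<close>

definition doubling :: "com \<Rightarrow> aexp \<Rightarrow> vname \<Rightarrow> com" where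
  "doubling A c x = Loop (below (Var x (Lit 1)) c)
     (Seq (Assign x (Lit 0) (Var x (Lit 1)))
     (Seq (Assign x (Lit 1) (Mul (Lit 2) (Var x (Lit 1))))
       (query A (Var x (Lit 1)))))"

definition bisection :: "com \<Rightarrow> aexp \<Rightarrow> vname \<Rightarrow> com" where
  "bisection A c x = Loop (Less (Add (Var x (Lit 0)) (Lit 1)) (Var x (Lit 1)))
     (Seq (Assign x (Lit 2) (Quot (Add (Var x (Lit 0)) (Var x (Lit 1))) (Lit 2)))
     (Seq (query A (Var x (Lit 2)))
       (Cond (below (Var x (Lit 2)) c)
         (Assign x (Lit 0) (Var x (Lit 2)))
         (Assign x (Lit 1) (Var x (Lit 2))))))"

definition search :: "com \<Rightarrow> aexp \<Rightarrow> vname \<Rightarrow> com" where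
  "search A c x =
     Seq (Assign x (Lit 0) (Lit 0))
    (Seq (Assign x (Lit 1) (Lit 1))
    (Seq (query A (Var x (Lit 1)))
    (Seq (doubling A c x)
    (Seq (bisection A c x)
      (Assign ''res'' (Lit 0) (Var x (Lit 1)))))))"

locale threshold_search =
  fixes A :: com and inp :: "int list" and M :: "int \<Rightarrow> int" and T :: real
    and c :: aexp and r :: int and x :: vname
  assumes oracle_computes: "computes A inp [k] (M k) T"
    and below_iff: "k - M k < aval inp c s \<longleftrightarrow> k < r"
    and fresh: "x \<notin> assigned A" "x \<noteq> ''arg''" "x \<noteq> ''res''"
begin

lemma T_ge_1: "1 \<le> T"
  using oracle_computes by (rule computes_time_ge_1)

text \<open>\<open>40 + 2 * real (acost c)\<close> is a uniform price per round in units of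
  \<open>T\<close>: \<open>w\<close> is the overhead around one call, and \<open>1 \<le> T\<close>
  absorbs it. The factor \<open>k\<close> covers leaving a loop with budget for further rounds
  unspent.\<close>

lemma cost_le:
  assumes "w \<le> 39 + 2 * real (acost c)" "1 \<le> k"
  shows "w + T \<le> k * (40 + 2 * real (acost c)) * T"
proof -
  have "(39 + 2 * real (acost c)) * 1 \<le> (39 + 2 * real (acost c)) * T"
    using T_ge_1 by (intro mult_left_mono) auto
  then have "w + T \<le> 1 * (40 + 2 * real (acost c)) * T"
    using assms(1) by (simp add: algebra_simps)
  also have "\<dots> \<le> k * (40 + 2 * real (acost c)) * T"
    using assms(2) T_ge_1 by (intro mult_right_mono) auto
  finally show ?thesis .
qed

lemma runs_query:
  assumes "\<And>s'. s' ''res'' 0 = M (aval inp e s) \<Longrightarrow> s' x = s x \<Longrightarrow> Q s'"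
    and "2 + real (acost e) + T \<le> N"
  shows "runs inp (query A e) s N Q"
proof -
  let ?s = "s(''arg'' := (s ''arg'')(0 := aval inp e s))"
  have "computes A inp [?s ''arg'' 0] (M (aval inp e s)) T"
    using oracle_computes by simp
  then have "runs inp A ?s T (\<lambda>s'. s' ''res'' 0 = M (aval inp e s) \<and> s' x = ?s x)"
    using fresh(1) by (rule runs_call)
  then have "runs inp A ?s T Q"
    by (rule runs_mono) (use assms(1) fresh in auto)
  then have "runs inp (query A e) s ((2 + real (acost e)) + T) Q"
    unfolding query_def by (intro runs_Seq runs_Assign) auto
  then show ?thesis
    using assms(2) by (rule runs_mono)
qed

text \<open>\<open>l\<close> bounds the doublings still to come. The invariant keeps the gap between
  the two ends a power of two, so that bisection can later halve it exactly.\<close>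

lemma runs_doubling:
  assumes "s x 1 = 2 ^ a" "s x 1 = s x 0 + 2 ^ b" "b \<le> a" "s x 0 < r"
    "s ''res'' 0 = M (s x 1)" "r \<le> 2 ^ (a + l)"
  shows "runs inp (doubling A c x) s ((real l + 1) * (40 + 2 * real (acost c)) * T)
    (\<lambda>s'. \<exists>b \<le> a + l. s' x 1 = s' x 0 + 2 ^ b \<and> s' x 0 < r \<and> r \<le> s' x 1)"
  using assms
proof (induction l arbitrary: s a b)
  case 0
  show ?case
    unfolding doubling_def
  proof (rule runs_LoopFalse)
    show "\<not> bval inp (below (Var x (Lit 1)) c) s"
      using 0 below_iff[of "s x 1" s] by (simp add: below_def)
    show "\<exists>b \<le> a + 0. s x 1 = s x 0 + 2 ^ b \<and> s x 0 < r \<and> r \<le> s x 1"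
      using 0 by auto
  qed (use T_ge_1 cost_le[of "7 + real (acost c)" 1] in \<open>simp add: below_def\<close>)
next
  case (Suc l)
  let ?post = "\<lambda>s'. \<exists>b \<le> a + Suc l. s' x 1 = s' x 0 + 2 ^ b \<and> s' x 0 < r \<and> r \<le> s' x 1"
  let ?N = "(real l + 1) * (40 + 2 * real (acost c)) * T"
  show ?case
  proof (cases "s x 1 < r")
    case False
    show ?thesis
      unfolding doubling_def
    proof (rule runs_LoopFalse)
      show "\<not> bval inp (below (Var x (Lit 1)) c) s"
        using False below_iff[of "s x 1" s] Suc.prems by (simp add: below_def)
      show "?post s"
        using Suc.prems False by (intro exI[of _ b] conjI) linarith+
    qed (use T_ge_1 cost_le[of "7 + real (acost c)" "real (Suc l) + 1"] in \<open>simp add: below_def\<close>)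
  next
    case True
    then have cond: "bval inp (below (Var x (Lit 1)) c) s"
      using below_iff[of "s x 1" s] Suc.prems by (simp add: below_def)
    have step: "runs inp (doubling A c x) s' ?N ?post"
      if "s' x 0 = s x 1" "s' x 1 = 2 * s x 1" "s' ''res'' 0 = M (s' x 1)" for s'
      \<comment> \<open>After a doubling the ends are \<open>2 ^ a\<close> and
        \<open>2 ^ Suc a\<close>, so the exponent of the gap becomes \<open>a\<close>.\<close>
      by (rule runs_mono[OF Suc.IH[of s' "Suc a" a]]) (use that True Suc.prems in auto)
    have "runs inp (Seq (Assign x (Lit 0) (Var x (Lit 1)))
        (Seq (Assign x (Lit 1) (Mul (Lit 2) (Var x (Lit 1)))) (query A (Var x (Lit 1))))) s
        (4 + (6 + (4 + T))) (\<lambda>s'. runs inp (doubling A c x) s' ?N ?post)"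
      by (rule runs_Seq runs_Assign runs_query step)+ simp_all
    moreover have "1 + real (bcost (below (Var x (Lit 1)) c)) + (4 + (6 + (4 + T))) + ?N
        \<le> (real (Suc l) + 1) * (40 + 2 * real (acost c)) * T"
      using cost_le[of "21 + real (acost c)" 1] T_ge_1 by (simp add: below_def algebra_simps)
    ultimately show ?thesis
      unfolding doubling_def by (rule runs_LoopTrue[OF cond])
  qed
qed

text \<open>The threshold stays above the lower end and at most the upper one. The gap
  \<open>2 ^ b\<close> halves in every round, and at gap 1 the upper end is
  \<open>r\<close>.\<close>

lemma runs_bisection:
  assumes "s x 1 = s x 0 + 2 ^ b" "s x 0 < r" "r \<le> s x 1"
  shows "runs inp (bisection A c x) s ((real b + 1) * (40 + 2 * real (acost c)) * T)
    (\<lambda>s'. s' x 1 = r)"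
  using assms
proof (induction b arbitrary: s)
  case 0
  show ?case
    unfolding bisection_def
    by (rule runs_LoopFalse) (use 0 T_ge_1 cost_le[of 8 1] in simp_all)
next
  case (Suc b)
  let ?N = "(real b + 1) * (40 + 2 * real (acost c)) * T"
  let ?m = "s x 0 + 2 ^ b"
  have mid: "(s x 0 + s x 1) div 2 = ?m"
    using Suc.prems by simp
  have "(1::int) \<le> 2 ^ b"
    by simp
  then have "s x 0 + 1 < s x 1"
    using Suc.prems(1) unfolding power_Suc by linarith
  then have cond: "bval inp (Less (Add (Var x (Lit 0)) (Lit 1)) (Var x (Lit 1))) s"
    by simp
  have lower: "runs inp (bisection A c x) s' ?N (\<lambda>s'. s' x 1 = r)"
    if "s' x 0 = ?m" "s' x 1 = s x 1" "?m < r" for s'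
    using that Suc.prems by (intro Suc.IH) auto
  have upper: "runs inp (bisection A c x) s' ?N (\<lambda>s'. s' x 1 = r)"
    if "s' x 0 = s x 0" "s' x 1 = ?m" "r \<le> ?m" for s'
    using that Suc.prems by (intro Suc.IH) auto
  have branch: "runs inp (Cond (below (Var x (Lit 2)) c)
      (Assign x (Lit 0) (Var x (Lit 2))) (Assign x (Lit 1) (Var x (Lit 2)))) s'
      (11 + real (acost c)) (\<lambda>s'. runs inp (bisection A c x) s' ?N (\<lambda>s'. s' x 1 = r))"
    if "s' x 0 = s x 0" "s' x 1 = s x 1" "s' x 2 = ?m" "s' ''res'' 0 = M ?m" for s'
  proof -
    have "bval inp (below (Var x (Lit 2)) c) s' \<longleftrightarrow> ?m < r"
      using that below_iff[of ?m s'] by (simp add: below_def)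
    then show ?thesis
      using that
      by (intro runs_Cond[where N = 4 and Q = "\<lambda>s'. runs inp (bisection A c x) s' ?N (\<lambda>s'. s' x 1 = r)"]
          runs_Assign lower upper) (simp_all add: below_def)
  qed
  have "runs inp (Seq (Assign x (Lit 2) (Quot (Add (Var x (Lit 0)) (Var x (Lit 1))) (Lit 2)))
      (Seq (query A (Var x (Lit 2)))
        (Cond (below (Var x (Lit 2)) c)
          (Assign x (Lit 0) (Var x (Lit 2)))
          (Assign x (Lit 1) (Var x (Lit 2)))))) s
      (9 + ((4 + T) + (11 + real (acost c))))
      (\<lambda>s'. runs inp (bisection A c x) s' ?N (\<lambda>s'. s' x 1 = r))"
    by (rule runs_Seq runs_Assign runs_query branch)+ (use mid in simp_all)
  moreover have "1 + real (bcost (Less (Add (Var x (Lit 0)) (Lit 1)) (Var x (Lit 1))))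
      + (9 + ((4 + T) + (11 + real (acost c)))) + ?N
      \<le> (real (Suc b) + 1) * (40 + 2 * real (acost c)) * T"
    using cost_le[of "32 + real (acost c)" 1] T_ge_1 by (simp add: algebra_simps)
  ultimately show ?case
    unfolding bisection_def by (rule runs_LoopTrue[OF cond])
qed

text \<open>At most \<open>l\<close> doublings leave a gap \<open>2 ^ b\<close> with
  \<open>b \<le> l\<close>, hence at most \<open>l\<close> halvings. The two loops account for
  \<open>80 + 4 * real (acost c)\<close>, and the remaining 40 pays for the \<open>14 + T\<close>
  steps outside them.\<close>

lemma search_computes:
  assumes "0 < r" "r \<le> 2 ^ l"
  shows "computes (search A c x) inp [] r ((real l + 1) * (120 + 4 * real (acost c)) * T)"
proof -
  let ?K = "40 + 2 * real (acost c)"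
  let ?N = "(real l + 1) * ?K * T"
  have store: "runs inp (Assign ''res'' (Lit 0) (Var x (Lit 1))) s 4 (\<lambda>s'. s' ''res'' 0 = r)"
    if "s x 1 = r" for s
    using that by (intro runs_Assign) simp_all
  have bisect: "runs inp (bisection A c x) s ?N
      (\<lambda>s'. runs inp (Assign ''res'' (Lit 0) (Var x (Lit 1))) s' 4 (\<lambda>s'. s' ''res'' 0 = r))"
    if "\<exists>b \<le> 0 + l. s x 1 = s x 0 + 2 ^ b \<and> s x 0 < r \<and> r \<le> s x 1" for s
    using that
  proof (elim exE conjE)
    fix b assume b: "b \<le> 0 + l" and inv: "s x 1 = s x 0 + 2 ^ b" "s x 0 < r" "r \<le> s x 1"
    show ?thesis
    proof (rule runs_mono[OF runs_bisection[of s b, OF inv]])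
      show "(real b + 1) * ?K * T \<le> ?N"
        using b T_ge_1 by (intro mult_right_mono) auto
    qed (rule store)
  qed
  have double: "runs inp (doubling A c x) s ?N
      (\<lambda>s'. runs inp (Seq (bisection A c x) (Assign ''res'' (Lit 0) (Var x (Lit 1)))) s' (?N + 4)
        (\<lambda>s'. s' ''res'' 0 = r))"
    if "s x 0 = 0" "s x 1 = 1" "s ''res'' 0 = M 1" for s
  proof (rule runs_mono)
    show "runs inp (doubling A c x) s ?N
        (\<lambda>s'. \<exists>b \<le> 0 + l. s' x 1 = s' x 0 + 2 ^ b \<and> s' x 0 < r \<and> r \<le> s' x 1)"
      using that assms by (intro runs_doubling[where b = 0]) simp_all
  qed (simp_all add: runs_Seq[OF bisect])
  have run: "runs inp (search A c x) s (3 + (3 + ((4 + T) + (?N + (?N + 4))))) (\<lambda>s'. s' ''res'' 0 = r)" for s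
    unfolding search_def
    by (rule runs_Seq runs_Assign runs_query double)+ simp_all
  have "T \<le> (real l + 1) * T"
    using T_ge_1 mult_right_mono[of 1 "real l + 1" T] by simp
  then have "14 + T \<le> (real l + 1) * 40 * T"
    using T_ge_1 by linarith
  then have "3 + (3 + ((4 + T) + (?N + (?N + 4)))) \<le> (real l + 1) * (120 + 4 * real (acost c)) * T"
    by (simp add: algebra_simps)
  then show ?thesis
    unfolding computes_iff_runs by (intro allI impI runs_mono[OF run])
qed

end

section \<open>Response times and mixing sets\<close>

text \<open>The integers are not well-ordered, so the minimum is taken over the natural-number
  offsets from the lower bound \<open>b\<close>.\<close>

lemma Least_int_bounded:
  fixes P :: "int \<Rightarrow> bool"
  assumes "P y" and "\<And>z. P z \<Longrightarrow> b \<le> z"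
  shows "P (LEAST z. P z)" and "(LEAST z. P z) \<le> y"
proof -
  define j where "j = (LEAST j::nat. P (b + int j))"
  have "P (b + int (nat (y - b)))"
    using assms by simp
  then have P: "P (b + int j)"
    unfolding j_def by (rule LeastI)
  have le: "b + int j \<le> z" if "P z" for z
  proof -
    have "j \<le> nat (z - b)"
      unfolding j_def using that assms(2)[OF that] by (intro Least_le) simp
    then show ?thesis
      using assms(2)[OF that] by linarith
  qed
  have "(LEAST z. P z) = b + int j"
    using P le by (rule Least_equality)
  then show "P (LEAST z. P z)" "(LEAST z. P z) \<le> y"
    using P le assms(1) by auto
qed

section \<open>Demand of the first n - 1 tasks and bounds on the response time\<close>

locale tasks =
  fixes n :: nat and c d p J :: "nat \<Rightarrow> nat"
  assumes task_system: "task_system n c d p J"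
begin

text \<open>The argument is an integer because the substitution t = k - s also produces negative
  values.\<close>

definition demand :: "int \<Rightarrow> int" where
  "demand t = (\<Sum>i\<in>{1..<n}. int (c i) * \<lceil>real_of_int t / real (p i)\<rceil>)"

definition util :: real where
  "util = (\<Sum>i\<in>{1..<n}. real (c i) / real (p i))"

lemma n_ge_2: "2 \<le> n"
  and c_pos: "i \<in> {1..n} \<Longrightarrow> 1 \<le> c i"
  and p_pos: "i \<in> {1..n} \<Longrightarrow> 1 \<le> p i"
  and util_less_1: "util < 1"
  using task_system unfolding task_system_def util_def by (auto intro: order_trans)

lemma atLeastAtMost_1_n: "{1..n} = insert n {1..<n}"
  using n_ge_2 by auto

lemma util_n: "util + real (c n) / real (p n) \<le> 1"
  using task_system unfolding task_system_def util_def atLeastAtMost_1_n by simp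

lemma util_nonneg: "0 \<le> util"
  unfolding util_def by (intro sum_nonneg) auto

lemma demand_ge: "util * real_of_int t \<le> real_of_int (demand t)"
  unfolding util_def demand_def of_int_sum sum_distrib_right
proof (rule sum_mono)
  fix i assume "i \<in> {1..<n}"
  have "real (c i) * (real_of_int t / real (p i)) \<le> real (c i) * real_of_int \<lceil>real_of_int t / real (p i)\<rceil>"
    by (intro mult_left_mono) auto
  then show "real (c i) / real (p i) * real_of_int t
      \<le> real_of_int (int (c i) * \<lceil>real_of_int t / real (p i)\<rceil>)"
    by simp
qed

lemma demand_le: "real_of_int (demand t) \<le> util * real_of_int t + real (\<Sum>i\<in>{1..<n}. c i)"
  unfolding util_def demand_def of_int_sum of_nat_sum sum_distrib_right sum.distrib[symmetric]
proof (rule sum_mono)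
  fix i assume "i \<in> {1..<n}"
  have "real (c i) * real_of_int \<lceil>real_of_int t / real (p i)\<rceil> \<le> real (c i) * (real_of_int t / real (p i) + 1)"
    by (intro mult_left_mono) auto
  then show "real_of_int (int (c i) * \<lceil>real_of_int t / real (p i)\<rceil>)
      \<le> real (c i) / real (p i) * real_of_int t + real (c i)"
    by (simp add: algebra_simps)
qed

lemma p_le_p_max: "i \<in> {1..n} \<Longrightarrow> p i \<le> p_max n p"
  unfolding p_max_def by (intro Max_ge) auto

text \<open>Each \<open>c i\<close> is at most its utilisation \<open>c i / p i\<close> times
  \<open>p_max n p\<close>, and the utilisations sum to at most 1.\<close>

lemma sum_c_le_p_max: "(\<Sum>i\<in>{1..n}. c i) \<le> p_max n p"
proof -
  have "real (\<Sum>i\<in>{1..n}. c i) \<le> (\<Sum>i\<in>{1..n}. real (c i) / real (p i) * real (p_max n p))"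
    unfolding of_nat_sum
  proof (rule sum_mono)
    fix i assume i: "i \<in> {1..n}"
    have "real (c i) = real (c i) / real (p i) * real (p i)"
      using p_pos[OF i] by simp
    also have "\<dots> \<le> real (c i) / real (p i) * real (p_max n p)"
      using p_le_p_max[OF i] by (intro mult_left_mono) auto
    finally show "real (c i) \<le> \<dots>" .
  qed
  also have "\<dots> = (\<Sum>i\<in>{1..n}. real (c i) / real (p i)) * real (p_max n p)"
    by (simp add: sum_distrib_right)
  also have "\<dots> \<le> 1 * real (p_max n p)"
    using task_system unfolding task_system_def by (intro mult_right_mono) auto
  finally show ?thesis
    by (simp only: mult_1 of_nat_le_iff)
qed

lemma response_time_eq: "response_time n c p = (LEAST t. int (c n) + demand (int t) \<le> int t)"
  unfolding response_time_def demand_def by simp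

text \<open>By \<open>util_n\<close>, \<open>(1 - util) * t\<close> is at least
  \<open>c n / p n * t\<close>. At \<open>t = p n * S\<close>, where \<open>S\<close> is the sum of
  all \<open>c i\<close>, this equals \<open>c n * S\<close>, hence is at least \<open>S\<close>:
  enough for \<open>c n\<close> and for the rounding loss of at most \<open>c i\<close> for each
  other task.\<close>

lemma feasible_square:
  "\<exists>t \<le> (p_max n p)\<^sup>2. int (c n) + demand (int t) \<le> int t"
proof (intro exI conjI)
  let ?S = "\<Sum>i\<in>{1..n}. c i"
  let ?t = "p n * ?S"
  show "?t \<le> (p_max n p)\<^sup>2"
    unfolding power2_eq_square
    using p_le_p_max[of n] sum_c_le_p_max n_ge_2 by (intro mult_mono) auto
  have "1 \<le> p n" "1 \<le> c n"
    using p_pos c_pos n_ge_2 by auto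
  then have "real (c n) / real (p n) * real ?t = real (c n) * real ?S"
    by simp
  moreover have "real ?S \<le> real (c n) * real ?S"
    using mult_right_mono[of 1 "real (c n)" "real ?S", OF _ of_nat_0_le_iff] \<open>1 \<le> c n\<close> by simp
  moreover have "(util + real (c n) / real (p n)) * real ?t \<le> 1 * real ?t"
    by (rule mult_right_mono[OF util_n of_nat_0_le_iff])
  ultimately have "util * real ?t + real ?S \<le> real ?t"
    by (simp only: distrib_right)
  moreover have "real ?S = real (c n) + real (\<Sum>i\<in>{1..<n}. c i)"
    unfolding atLeastAtMost_1_n by simp
  ultimately have "real_of_int (int (c n) + demand (int ?t)) \<le> real_of_int (int ?t)"
    using demand_le[of "int ?t"] by simp
  then show "int (c n) + demand (int ?t) \<le> int ?t"
    by (simp only: of_int_le_iff)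
qed

lemma response_time_feasible:
  "int (c n) + demand (int (response_time n c p)) \<le> int (response_time n c p)"
  using feasible_square LeastI_ex[of "\<lambda>t. int (c n) + demand (int t) \<le> int t"]
  unfolding response_time_eq by blast

lemma response_time_le: "int (c n) + demand (int t) \<le> int t \<Longrightarrow> response_time n c p \<le> t"
  unfolding response_time_eq by (rule Least_le)

lemma response_time_le_square: "response_time n c p \<le> (p_max n p)\<^sup>2"
  using feasible_square response_time_le by (meson order_trans)

text \<open>For \<open>t \<le> 0\<close>, \<open>util < 1\<close> gives
  \<open>t \<le> util * t \<le> demand t\<close>, which leaves no room for \<open>c n\<close>. Thus
  the negative points of the mixing problem cannot produce spurious solutions.\<close>

lemma feasible_pos:
  assumes "int (c n) + demand t \<le> t"
  shows "0 < t"
proof (rule ccontr)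
  assume "\<not> 0 < t"
  then have "1 * real_of_int t \<le> util * real_of_int t"
    using util_less_1 by (intro mult_right_mono_neg) auto
  then have "real_of_int t \<le> real_of_int (demand t)"
    using demand_ge[of t] by simp
  then show False
    using assms c_pos[of n] n_ge_2 by simp
qed

lemma response_time_pos: "0 < response_time n c p"
  using feasible_pos[OF response_time_feasible] by simp

section \<open>The mixing set expressed through the demand\<close>

lemma demand_le_sum:
  assumes "\<And>i. i \<in> {1..<n} \<Longrightarrow> t \<le> int (p i) * x i"
  shows "demand t \<le> (\<Sum>i\<in>{1..<n}. int (c i) * x i)"
  unfolding demand_def
proof (intro sum_mono mult_left_mono)
  fix i assume i: "i \<in> {1..<n}"
  have "real_of_int t \<le> real_of_int (int (p i) * x i)"
    using assms[OF i] by (simp only: of_int_le_iff)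
  then show "\<lceil>real_of_int t / real (p i)\<rceil> \<le> x i"
    using p_pos[of i] i by (auto simp: ceiling_le_iff divide_le_eq mult.commute)
qed auto

definition mixing_set :: "int \<Rightarrow> int set" where
  "mixing_set k = {s + (\<Sum>i\<in>{1..<n}. int (c i) * x i) | s x.
     s \<ge> 0 \<and> (\<forall>i\<in>{1..<n}. s + int (p i) * x i \<ge> k)}"

text \<open>With \<open>t = k - s\<close> the constraints force each \<open>x i\<close> to be at
  least the ceiling of \<open>t / p i\<close>.\<close>

lemma mixing_setE:
  assumes "m \<in> mixing_set k"
  obtains t where "t \<le> k" "k - t + demand t \<le> m"
proof -
  obtain s x where m: "m = s + (\<Sum>i\<in>{1..<n}. int (c i) * x i)" and "s \<ge> 0"
    and x: "\<And>i. i \<in> {1..<n} \<Longrightarrow> k \<le> s + int (p i) * x i"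
    using assms unfolding mixing_set_def by blast
  have "demand (k - s) \<le> (\<Sum>i\<in>{1..<n}. int (c i) * x i)"
    using x by (intro demand_le_sum) (simp add: algebra_simps)
  then show ?thesis
    using that[of "k - s"] m \<open>s \<ge> 0\<close> by simp
qed

text \<open>Conversely, \<open>s = k - t\<close> with these ceilings as \<open>x\<close> is
  admissible. Minimising over the mixing set therefore amounts to minimising
  \<open>k - t + demand t\<close> over \<open>t \<le> k\<close>.\<close>

lemma mixing_setI:
  assumes "t \<le> k"
  shows "k - t + demand t \<in> mixing_set k"
proof -
  have "k \<le> k - t + int (p i) * \<lceil>real_of_int t / real (p i)\<rceil>" if "i \<in> {1..<n}" for i
  proof -
    have "1 \<le> p i"
      using p_pos[of i] that by simp
    then have "real_of_int t = real (p i) * (real_of_int t / real (p i))"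
      by simp
    also have "\<dots> \<le> real (p i) * real_of_int \<lceil>real_of_int t / real (p i)\<rceil>"
      by (intro mult_left_mono) auto
    finally have "real_of_int t \<le> real_of_int (int (p i) * \<lceil>real_of_int t / real (p i)\<rceil>)"
      by simp
    then show ?thesis
      by (simp only: of_int_le_iff)
  qed
  then show ?thesis
    using assms unfolding mixing_set_def demand_def by fastforce
qed

lemma mixing_min_eq: "mixing_min n c p k = (LEAST m. m \<in> mixing_set k)"
  unfolding mixing_min_def mixing_set_def ..

text \<open>Since util lies in [0, 1), \<open>demand t\<close> is at least \<open>min 0 t\<close>.
  This makes the integer \<open>LEAST\<close> in \<open>mixing_min\<close> an attained
  minimum.\<close>

lemma mixing_set_bounded:
  assumes "m \<in> mixing_set k"
  shows "min 0 k \<le> m"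
proof -
  obtain t where t: "t \<le> k" "k - t + demand t \<le> m"
    using assms by (rule mixing_setE)
  have "min 0 (real_of_int t) \<le> util * real_of_int t"
  proof (cases "0 \<le> t")
    case True
    then show ?thesis
      using util_nonneg by simp
  next
    case False
    then have "1 * real_of_int t \<le> util * real_of_int t"
      using util_less_1 by (intro mult_right_mono_neg) auto
    then show ?thesis
      by simp
  qed
  then have "real_of_int (min 0 t) \<le> real_of_int (demand t)"
    using demand_ge[of t] by simp
  then have "min 0 t \<le> demand t"
    by (simp only: of_int_le_iff)
  then show ?thesis
    using t by linarith
qed

lemma mixing_min_in: "mixing_min n c p k \<in> mixing_set k"
  and mixing_min_le: "m \<in> mixing_set k \<Longrightarrow> mixing_min n c p k \<le> m"
  unfolding mixing_min_eq
  using Least_int_bounded[of "\<lambda>m. m \<in> mixing_set k", OF _ mixing_set_bounded] mixing_setI[of k k]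
  by blast+

text \<open>Feasibility of a single \<open>t\<close> need not be monotone in \<open>t\<close>, but
  the maximum of \<open>t - demand t\<close> over all \<open>t \<le> k\<close> is monotone in
  \<open>k\<close>; hence bisection is sound.\<close>

lemma below_response_time_iff:
  "k - mixing_min n c p k < int (c n) \<longleftrightarrow> k < int (response_time n c p)"
proof -
  have "int (response_time n c p) \<le> k" if "int (c n) \<le> k - mixing_min n c p k"
  proof -
    obtain t where t: "t \<le> k" "k - t + demand t \<le> mixing_min n c p k"
      using mixing_min_in by (rule mixing_setE)
    then have f: "int (c n) + demand t \<le> t"
      using that by linarith
    then have "response_time n c p \<le> nat t"
      using feasible_pos[OF f] by (intro response_time_le) simp
    then show ?thesis
      using t(1) feasible_pos[OF f] by linarith
  qed
  moreover have "int (c n) \<le> k - mixing_min n c p k" if "int (response_time n c p) \<le> k"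
    using mixing_min_le[OF mixing_setI[OF that]] response_time_feasible by linarith
  ultimately show ?thesis
    by linarith
qed

text \<open>Two tasks with \<open>c i \<ge> 1\<close> already contribute 2 to the sum in
  \<open>sum_c_le_p_max\<close>. It makes the logarithm at least 1, so that additive constants fit
  into the final bound.\<close>

lemma p_max_ge_2: "2 \<le> p_max n p"
proof -
  have "{1, 2} \<subseteq> {1..n}"
    using n_ge_2 by auto
  then have "(\<Sum>i\<in>{1, 2}. c i) \<le> (\<Sum>i\<in>{1..n}. c i)"
    by (intro sum_mono2) auto
  then show ?thesis
    using sum_c_le_p_max c_pos[of 1] c_pos[of 2] n_ge_2 by simp
qed

end

text \<open>The parameter \<open>c n\<close> sits at address \<open>4 n - 3\<close>, after the leading \<open>n\<close> and \<open>n - 1\<close> blocks of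
  length 4.\<close>

lemma encode_c_n:
  assumes "1 \<le> n"
  shows "aval (encode n c d p J) (Read (Sub (Mul (Lit 4) (Read (Lit 0))) (Lit 3))) s = int (c n)"
proof -
  let ?f = "\<lambda>i. [int (c i), int (d i), int (p i), int (J i)]"
  have "length (concat (map ?f xs)) = 4 * length xs" for xs
    by (induction xs) auto
  then have len: "length (concat (map ?f [1..<n])) = 4 * (n - 1)"
    by simp
  define xs where "xs = int n # concat (map ?f [1..<n])"
  have "encode n c d p J = xs @ ?f n"
    using assms unfolding encode_def xs_def by simp
  moreover have "length xs = 4 * n - 3"
    unfolding xs_def list.size len using assms by simp
  ultimately have "encode n c d p J ! (4 * n - 3) = int (c n)"
    and "length (encode n c d p J) = 4 * n - 3 + 4"
    using nth_append_length[of xs] by simp_all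
  moreover have "encode n c d p J ! 0 = int n" "nat (4 * int n - 3) = 4 * n - 3"
    by (auto simp: encode_def)
  ultimately show ?thesis
    using assms by simp
qed

theorem theorem20:
  "\<exists>C::real. \<forall>A::com. \<exists>B::com. \<forall>n c d p J (T::real).
     task_system n c d p J \<longrightarrow>
     (\<forall>k::int. computes A (encode n c d p J) [k] (mixing_min n c p k) T) \<longrightarrow>
     computes B (encode n c d p J) [] (int (response_time n c p))
       (C * (T * log 2 (real (p_max n p))))"
\<comment> \<open>592 = 4 * 148, where 148 = 120 + 4 * 7 and 7 is the cost of the expression reading
  \<open>c n\<close>; the factor 4 comes from
  \<open>real l + 1 \<le> 4 * log 2 (real (p_max n p))\<close>.\<close>
proof (intro exI[of _ "592::real"] allI)
  fix A :: com
  let ?e = "Read (Sub (Mul (Lit 4) (Read (Lit 0))) (Lit 3))"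
  \<comment> \<open>\<open>A\<close> assigns only finitely many names, so an array for the search
    state can be chosen from \<open>A\<close> alone, before the instance is known.\<close>
  have "\<exists>x :: vname. x \<notin> assigned A \<union> {''arg'', ''res''}"
    by (intro ex_new_if_finite infinite_UNIV_listI) (simp add: finite_assigned)
  then obtain x :: vname where x: "x \<notin> assigned A" "x \<noteq> ''arg''" "x \<noteq> ''res''"
    by blast
  show "\<exists>B::com. \<forall>n c d p J (T::real).
     task_system n c d p J \<longrightarrow>
     (\<forall>k::int. computes A (encode n c d p J) [k] (mixing_min n c p k) T) \<longrightarrow>
     computes B (encode n c d p J) [] (int (response_time n c p))
       (592 * (T * log 2 (real (p_max n p))))"
  proof (intro exI[of _ "search A ?e x"] allI impI)
    fix n c d p J and T :: real
    assume "task_system n c d p J"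
      and A: "\<forall>k. computes A (encode n c d p J) [k] (mixing_min n c p k) T"
    then interpret tasks n c d p J
      by unfold_locales
    interpret threshold_search A "encode n c d p J" "mixing_min n c p" T ?e
        "int (response_time n c p)" x
    proof
      show "k - mixing_min n c p k < aval (encode n c d p J) ?e s
          \<longleftrightarrow> k < int (response_time n c p)" for k s
        using n_ge_2 by (subst encode_c_n) (simp_all add: below_response_time_iff)
    qed (use A x in auto)
    \<comment> \<open>The factor 2 reflects that the response time is bounded by the square of
      \<open>p_max n p\<close>.\<close>
    define l where "l = nat \<lceil>2 * log 2 (real (p_max n p))\<rceil>"
    have log: "1 \<le> log 2 (real (p_max n p))"
      using p_max_ge_2 by simp
    then have l: "2 * log 2 (real (p_max n p)) \<le> real l" "real l \<le> 2 * log 2 (real (p_max n p)) + 1"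
      unfolding l_def by linarith+
    have "real ((p_max n p)\<^sup>2) = 2 powr (2 * log 2 (real (p_max n p)))"
      using p_max_ge_2 by (simp add: powr_mult_base powr_powr[symmetric] mult.commute[of 2])
    also have "\<dots> \<le> 2 powr real l"
      using l(1) by simp
    also have "\<dots> = real (2 ^ l)"
      by (simp add: powr_realpow)
    finally have "(p_max n p)\<^sup>2 \<le> 2 ^ l"
      by (simp only: of_nat_le_iff)
    then have "response_time n c p \<le> 2 ^ l"
      using response_time_le_square by linarith
    then have "int (response_time n c p) \<le> 2 ^ l"
      by (metis of_nat_le_iff of_nat_numeral of_nat_power)
    then have "computes (search A ?e x) (encode n c d p J) [] (int (response_time n c p))
        ((real l + 1) * (120 + 4 * real (acost ?e)) * T)"
      using response_time_pos by (intro search_computes) simp_all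
    moreover have "(real l + 1) * (120 + 4 * real (acost ?e)) * T
        \<le> 592 * (T * log 2 (real (p_max n p)))"
    proof -
      have "real l + 1 \<le> 4 * log 2 (real (p_max n p))"
        using l(2) log by linarith
      then have "(real l + 1) * (148 * T) \<le> 4 * log 2 (real (p_max n p)) * (148 * T)"
        using T_ge_1 by (intro mult_right_mono) auto
      then show ?thesis
        by (simp add: algebra_simps)
    qed
    ultimately show "computes (search A ?e x) (encode n c d p J) [] (int (response_time n c p))
        (592 * (T * log 2 (real (p_max n p))))"
      by (rule computes_mono)
  qed
qed

end
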